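(* Fix $d\ge1$ and let $\{S_N\}$ be a family of nonempty sets $S_N\subseteq\mathbb Z_N^d$ ($N$ ranging over an unbounded set of moduli) with $|S_N|=N^{\alpha+o(1)}$, where $0<\alpha<d$. Let $r>2$ and $0\leq s\leq\frac12$. If $\{S_N\}$ is uniformly $(r,s)$-Salem, then $$\overline\kappa(\{1_{S_N}\})\leq\min\left\{\frac{\alpha}{2},\ \frac{\alpha r(1-2s)}{2(r-2)}\right\}.$$ In particular, a uniform $(r,\frac{1}{2})$-Salem estimate for any $r>2$ forces the finite-scale concentration exponents $\kappa_N(1_{S_N})$ to tend to zero.
   Context: $\mathbb Z_N=\mathbb Z/N\mathbb Z$, $N\ge2$; all limits are taken within the given unbounded set of moduli. For $f:\mathbb Z_N^d\to\mathbb C$ the unitary Fourier transform is $\widehat f(\xi)=N^{-d/2}\sum_{x\in\mathbb Z_N^d}f(x)e^{-2\pi i x\cdot\xi/N}$. Norms use counting measure: $\|f\|_r=(\sum_x|f(x)|^r)^{1/r}$. $1_S$ is the indicator of $S$. For $f\neq0$, $\operatorname{FR}(f)=\|\widehat f\|_1/\|\widehat f\|_2$ and $\kappa_N(f)=\log\bigl(N^{d/2}/\operatorname{FR}(f)\bigr)/\log N$; $\overline\kappa(\{f_N\})=\limsup_{N\to\infty}\kappa_N(f_N)$. $|S_N|=N^{\alpha+o(1)}$ means $\log|S_N|/\log N\to\alpha$. For $r>2$ and $0\le s\le\frac12$, the family $\{S_N\}$ is uniformly $(r,s)$-Salem if there is a constant $C$ independent of $N$ with $$\left(N^{-d}\sum_{\xi\in\mathbb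 Z_N^d,\ \xi\neq0}|\widehat{1_{S_N}}(\xi)|^r\right)^{\frac1r}\leq C\,N^{-\frac d2}|S_N|^{1-s}\quad\text{for all }N.$$ *)

theory Defs
  imports "HOL-Analysis.Analysis"
begin

text \<open>
  The group \<open>\<int>_N^d\<close> is represented by canonical representatives: vectors
  indexed by \<open>{..<d}\<close> with entries in \<open>{0..<N}\<close>, extended by \<open>undefined\<close>
  outside the index set. The origin must therefore be a restricted function as well.
  Functions on \<open>\<int>_N^d\<close> are total functions of which only the values on the
  representatives matter.
\<close>

definition zmod_vecs :: "nat \<Rightarrow> nat \<Rightarrow> (nat \<Rightarrow> int) set" where
  "zmod_vecs d N = {..<d} \<rightarrow>\<^sub>E {0..<int N}"

definition zmod_zero :: "nat \<Rightarrow> nat \<Rightarrow> int" where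
  "zmod_zero d = (\<lambda>i\<in>{..<d}. 0)"

definition zmod_dot :: "nat \<Rightarrow> (nat \<Rightarrow> int) \<Rightarrow> (nat \<Rightarrow> int) \<Rightarrow> int" where
  "zmod_dot d x \<xi> = (\<Sum>i<d. x i * \<xi> i)"

definition fourier :: "nat \<Rightarrow> nat \<Rightarrow> ((nat \<Rightarrow> int) \<Rightarrow> complex) \<Rightarrow> (nat \<Rightarrow> int) \<Rightarrow> complex" where
  "fourier d N f \<xi> =
     of_real (real N powr (- real d / 2)) *
     (\<Sum>x\<in>zmod_vecs d N. f x * exp (- 2 * of_real pi * \<i> * of_int (zmod_dot d x \<xi>) / of_nat N))"

definition lp_norm :: "nat \<Rightarrow> nat \<Rightarrow> real \<Rightarrow> ((nat \<Rightarrow> int) \<Rightarrow> complex) \<Rightarrow> real" where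
  "lp_norm d N r f = (\<Sum>x\<in>zmod_vecs d N. cmod (f x) powr r) powr (1 / r)"

definition fourier_ratio :: "nat \<Rightarrow> nat \<Rightarrow> ((nat \<Rightarrow> int) \<Rightarrow> complex) \<Rightarrow> real" where
  "fourier_ratio d N f = lp_norm d N 1 (fourier d N f) / lp_norm d N 2 (fourier d N f)"

definition kappa :: "nat \<Rightarrow> nat \<Rightarrow> ((nat \<Rightarrow> int) \<Rightarrow> complex) \<Rightarrow> real" where
  "kappa d N f = ln (real N powr (real d / 2) / fourier_ratio d N f) / ln (real N)"

text \<open>The filter of \<open>N \<rightarrow> \<infinity>\<close> within the set \<open>M\<close> of moduli.\<close>

definition moduli_at_top :: "nat set \<Rightarrow> nat filter" where
  "moduli_at_top M = inf at_top (principal M)"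

definition kappa_upper :: "nat set \<Rightarrow> nat \<Rightarrow> (nat \<Rightarrow> (nat \<Rightarrow> int) \<Rightarrow> complex) \<Rightarrow> ereal" where
  "kappa_upper M d f = Limsup (moduli_at_top M) (\<lambda>N. ereal (kappa d N (f N)))"

text \<open>\<open>|S\<^sub>N| = N\<^bsup>\<alpha>+o(1)\<^esup>\<close>\<close>

definition has_size_exponent :: "nat set \<Rightarrow> (nat \<Rightarrow> (nat \<Rightarrow> int) set) \<Rightarrow> real \<Rightarrow> bool" where
  "has_size_exponent M S \<alpha> \<longleftrightarrow>
     ((\<lambda>N. ln (real (card (S N))) / ln (real N)) \<longlongrightarrow> \<alpha>) (moduli_at_top M)"

definition uniformly_salem ::
    "nat set \<Rightarrow> nat \<Rightarrow> real \<Rightarrow> real \<Rightarrow> (nat \<Rightarrow> (nat \<Rightarrow> int) set) \<Rightarrow> bool" where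
  "uniformly_salem M d r s S \<longleftrightarrow>
     (\<exists>C::real. \<forall>N\<in>M.
        (real N powr (- real d) *
          (\<Sum>\<xi>\<in>zmod_vecs d N - {zmod_zero d}. cmod (fourier d N (indicator (S N)) \<xi>) powr r))
            powr (1 / r)
        \<le> C * real N powr (- real d / 2) * real (card (S N)) powr (1 - s))"

end

theory Submission
  imports Defs "HOL-Real_Asymp.Real_Asymp"
begin

text \<open>
  Write \<open>F\<close> for the Fourier transform of \<open>1\<^sub>S\<close> and \<open>n = |S|\<close>. By Parseval \<open>\<Sum>|F|\<^sup>2 = n\<close>, and
  \<open>|F| \<le> |F(0)| = N\<^bsup>-d/2\<^esup> n\<close>, so \<open>\<Sum>|F| \<ge> N\<^bsup>d/2\<^esup>\<close>, which gives the bound \<open>\<alpha>/2\<close>.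
  For the other bound, \<open>|F(0)|\<^sup>2 = n\<^sup>2/N\<^bsup>d\<^esup>\<close> is at most \<open>n/2\<close> for large \<open>N\<close> because \<open>\<alpha> < d\<close>,
  so the nonzero frequencies carry at least half of the energy. Interpolating their second moment
  between the first and the \<open>r\<close>-th one, the Salem estimate for the latter bounds the former from below.
\<close>

section \<open>Characters of the group and their orthogonality\<close>

text \<open>The summands are the powers of a single \<open>N\<close>-th root of unity
  \<open>z\<close>, so the sum is geometric; \<open>z = 1\<close> happens exactly when
  \<open>N\<close> divides \<open>a\<close>.\<close>

lemma sum_additive_character:
  fixes a :: int
  assumes "N > 0"
  shows "(\<Sum>k\<in>{0..<int N}. exp (- 2 * of_real pi * \<i> * of_int (a * k) / of_nat N))
       = (if int N dvd a then of_nat N else (0::complex))"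
proof -
  define z :: complex where "z = exp (- 2 * of_real pi * \<i> * of_int a / of_nat N)"
  have "(\<Sum>k\<in>{0..<int N}. exp (- 2 * of_real pi * \<i> * of_int (a * k) / of_nat N))
      = (\<Sum>k<N. exp (- 2 * of_real pi * \<i> * of_int (a * int k) / of_nat N :: complex))"
    by (rule sum.reindex_bij_witness[of _ int nat]) auto
  also have "\<dots> = (\<Sum>k<N. z ^ k)"
    unfolding z_def by (intro sum.cong refl) (simp add: exp_of_nat_mult[symmetric] mult_ac)
  also have "\<dots> = (if int N dvd a then of_nat N else 0)"
  proof (cases "int N dvd a")
    case True
    then obtain m where "a = int N * m" by (elim dvdE)
    then have "z = exp (2 * of_int (- m) * of_real pi * \<i>)"
      using assms by (simp add: z_def mult_ac)
    also have "\<dots> = 1"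
      using exp_integer_2pi[of "of_int (- m)"] by (simp add: mult_ac)
    finally show ?thesis using True by simp
  next
    case False
    have "z \<noteq> 1"
    proof
      assume "z = 1"
      then obtain m :: int where "- 2 * pi * of_int a / of_nat N = of_int (2 * m) * pi"
        unfolding z_def exp_eq_1 by auto
      then have "pi * real_of_int (- a) = pi * real_of_int (m * int N)"
        using assms by (simp add: field_simps)
      then have "real_of_int (- a) = real_of_int (m * int N)"
        by (simp only: mult_left_cancel[OF pi_neq_zero])
      then have "- a = m * int N" by linarith
      then have "a = int N * (- m)" by (simp add: mult.commute)
      then show False using False by (metis dvd_triv_left)
    qed
    moreover have "z ^ N = exp (2 * of_int (- a) * of_real pi * \<i>)"
      using assms by (simp add: z_def exp_of_nat_mult[symmetric] mult_ac)
    then have "z ^ N = 1"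
      using exp_integer_2pi[of "of_int (- a)"] by (simp add: mult_ac)
    ultimately show ?thesis using False by (simp add: geometric_sum)
  qed
  finally show ?thesis .
qed

lemma finite_zmod_vecs [simp]: "finite (zmod_vecs d N)"
  by (simp add: zmod_vecs_def finite_PiE)

lemma card_zmod_vecs: "card (zmod_vecs d N) = N ^ d"
  by (simp add: zmod_vecs_def card_PiE)

text \<open>The exponent is additive over coordinates, so the sum over vectors factors into
  one-dimensional character sums with frequencies \<open>x i - y i\<close>; a single coordinate
  where \<open>x\<close> and \<open>y\<close> differ kills the product.\<close>

lemma character_orthogonality:
  assumes "N > 0" and x: "x \<in> zmod_vecs d N" and y: "y \<in> zmod_vecs d N"
  shows "(\<Sum>\<xi>\<in>zmod_vecs d N. exp (- 2 * of_real pi * \<i> * of_int (zmod_dot d x \<xi>) / of_nat N)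
            * cnj (exp (- 2 * of_real pi * \<i> * of_int (zmod_dot d y \<xi>) / of_nat N)))
       = (if x = y then of_nat N ^ d else (0::complex))"
proof -
  let ?e = "\<lambda>k::int. exp (- 2 * of_real pi * \<i> * of_int k / of_nat N) :: complex"
  let ?w = "\<lambda>k::int. - 2 * of_real pi * \<i> * of_int k / of_nat N :: complex"
  have "?e (zmod_dot d x \<xi>) * cnj (?e (zmod_dot d y \<xi>)) = (\<Prod>i<d. ?e ((x i - y i) * \<xi> i))" for \<xi>
  proof -
    have "cnj (?e (zmod_dot d y \<xi>)) = exp (- ?w (zmod_dot d y \<xi>))"
      by (simp add: exp_cnj)
    then have "?e (zmod_dot d x \<xi>) * cnj (?e (zmod_dot d y \<xi>))
        = exp (?w (zmod_dot d x \<xi>) + - ?w (zmod_dot d y \<xi>))"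
      by (simp only: exp_add)
    also have "?w (zmod_dot d x \<xi>) + - ?w (zmod_dot d y \<xi>) = ?w (zmod_dot d x \<xi> - zmod_dot d y \<xi>)"
      by (simp add: diff_divide_distrib right_diff_distrib)
    also have "zmod_dot d x \<xi> - zmod_dot d y \<xi> = (\<Sum>i<d. (x i - y i) * \<xi> i)"
      by (simp add: zmod_dot_def left_diff_distrib sum_subtractf)
    also have "?w (\<Sum>i<d. (x i - y i) * \<xi> i) = (\<Sum>i<d. ?w ((x i - y i) * \<xi> i))"
      by (simp only: of_int_sum sum_distrib_left sum_divide_distrib)
    finally show ?thesis by (simp only: exp_sum[OF finite_lessThan])
  qed
  then have "(\<Sum>\<xi>\<in>zmod_vecs d N. ?e (zmod_dot d x \<xi>) * cnj (?e (zmod_dot d y \<xi>)))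
      = (\<Prod>i<d. \<Sum>k\<in>{0..<int N}. ?e ((x i - y i) * k))"
    unfolding zmod_vecs_def by (simp add: prod_sum_PiE)
  also have "\<dots> = (\<Prod>i<d. if int N dvd x i - y i then of_nat N else 0)"
    by (intro prod.cong refl sum_additive_character assms)
  also have "\<dots> = (if x = y then of_nat N ^ d else 0)"
  proof (cases "x = y")
    case False
    then obtain i where i: "i < d" "x i \<noteq> y i"
      using x y unfolding zmod_vecs_def by (meson PiE_ext lessThan_iff)
    have "x i \<in> {0..<int N}" "y i \<in> {0..<int N}"
      using x y i unfolding zmod_vecs_def by (auto simp: PiE_iff)
    \<comment> \<open>Both entries are canonical representatives, so their nonzero difference is
      smaller than \<open>N\<close> in absolute value.\<close>
    then have "\<not> int N dvd x i - y i"
      using i dvd_imp_le_int[of "x i - y i" "int N"] by auto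
    with i False show ?thesis by (auto intro!: prod_zero)
  qed simp
  finally show ?thesis .
qed

section \<open>Parseval and pointwise bounds for the transform\<close>

lemma powr_neg_half_squared:
  assumes "N > 0"
  shows "(real N powr (- real d / 2))\<^sup>2 = 1 / real N ^ d"
proof -
  have "(real N powr (- real d / 2))\<^sup>2 = real N powr (- real d)"
    by (simp add: power2_eq_square flip: powr_add)
  then show ?thesis
    using assms by (simp add: powr_minus_divide powr_realpow)
qed

text \<open>The squared modulus is expanded into a double sum over \<open>x\<close> and
  \<open>y\<close>. Summing over the frequency first leaves only the diagonal, whose factor
  \<open>N ^ d\<close> cancels against \<open>c * c\<close>, the square of the unitary
  normalisation.\<close>

lemma parseval:
  assumes "N > 0"
  shows "(\<Sum>\<xi>\<in>zmod_vecs d N. (cmod (fourier d N f \<xi>))\<^sup>2) = (\<Sum>x\<in>zmod_vecs d N. (cmod (f x))\<^sup>2)"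
proof -
  let ?V = "zmod_vecs d N"
  define e :: "(nat \<Rightarrow> int) \<Rightarrow> (nat \<Rightarrow> int) \<Rightarrow> complex"
    where "e x \<xi> = exp (- 2 * of_real pi * \<i> * of_int (zmod_dot d x \<xi>) / of_nat N)" for x \<xi>
  define c where "c = real N powr (- real d / 2)"
  have c2: "c * c = 1 / real N ^ d"
    using powr_neg_half_squared[OF assms] by (simp add: c_def power2_eq_square)
  have "complex_of_real (\<Sum>\<xi>\<in>?V. (cmod (fourier d N f \<xi>))\<^sup>2)
      = (\<Sum>\<xi>\<in>?V. fourier d N f \<xi> * cnj (fourier d N f \<xi>))"
    by (simp only: of_real_sum complex_norm_square)
  also have "\<dots> = (\<Sum>\<xi>\<in>?V. \<Sum>x\<in>?V. \<Sum>y\<in>?V. of_real (c * c) * (f x * cnj (f y)) * (e x \<xi> * cnj (e y \<xi>)))"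
  proof (intro sum.cong refl)
    fix \<xi>
    have "fourier d N f \<xi> * cnj (fourier d N f \<xi>)
        = of_real (c * c) * ((\<Sum>x\<in>?V. f x * e x \<xi>) * (\<Sum>y\<in>?V. cnj (f y) * cnj (e y \<xi>)))"
      by (simp add: fourier_def c_def e_def)
    also have "\<dots> = (\<Sum>x\<in>?V. \<Sum>y\<in>?V. of_real (c * c) * ((f x * e x \<xi>) * (cnj (f y) * cnj (e y \<xi>))))"
      by (subst sum_product) (simp only: sum_distrib_left)
    finally show "fourier d N f \<xi> * cnj (fourier d N f \<xi>)
        = (\<Sum>x\<in>?V. \<Sum>y\<in>?V. of_real (c * c) * (f x * cnj (f y)) * (e x \<xi> * cnj (e y \<xi>)))"
      by (simp only: mult_ac)
  qed
  also have "\<dots> = (\<Sum>x\<in>?V. \<Sum>y\<in>?V. \<Sum>\<xi>\<in>?V. of_real (c * c) * (f x * cnj (f y)) * (e x \<xi> * cnj (e y \<xi>)))"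
    by (rule trans[OF sum.swap], rule sum.cong[OF refl], rule sum.swap)
  also have "\<dots> = (\<Sum>x\<in>?V. \<Sum>y\<in>?V. of_real (c * c) * (f x * cnj (f y)) * (if x = y then of_nat N ^ d else 0))"
    by (intro sum.cong refl) (simp only: sum_distrib_left[symmetric] e_def character_orthogonality[OF assms])
  also have "\<dots> = (\<Sum>x\<in>?V. f x * cnj (f x))"
    unfolding c2 using assms by (simp add: if_distrib cong: if_cong)
  also have "\<dots> = of_real (\<Sum>x\<in>?V. (cmod (f x))\<^sup>2)"
    by (simp only: of_real_sum complex_norm_square)
  finally show ?thesis by (simp only: of_real_eq_iff)
qed

lemma cmod_fourier_le:
  "cmod (fourier d N f \<xi>) \<le> real N powr (- real d / 2) * (\<Sum>x\<in>zmod_vecs d N. cmod (f x))"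
proof -
  have "cmod (\<Sum>x\<in>zmod_vecs d N. f x * exp (- 2 * of_real pi * \<i> * of_int (zmod_dot d x \<xi>) / of_nat N))
      \<le> (\<Sum>x\<in>zmod_vecs d N. cmod (f x))"
    by (intro order_trans[OF norm_sum] sum_mono) (simp add: norm_mult)
  then show ?thesis by (simp add: fourier_def norm_mult mult_left_mono)
qed

lemma fourier_at_zero:
  "fourier d N f (zmod_zero d) = of_real (real N powr (- real d / 2)) * (\<Sum>x\<in>zmod_vecs d N. f x)"
proof -
  have "zmod_dot d x (zmod_zero d) = 0" for x
    by (simp add: zmod_dot_def zmod_zero_def)
  then show ?thesis by (simp add: fourier_def)
qed

text \<open>Jensen's inequality for \<open>t \<mapsto> t\<^bsup>r-1\<^esup>\<close> with weights \<open>a\<^sub>i / \<Sum>a\<close>.\<close>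

lemma powr_sum_squares_le:
  fixes a :: "'a \<Rightarrow> real"
  assumes "finite A" and nonneg: "\<And>i. i \<in> A \<Longrightarrow> 0 \<le> a i" and pos: "0 < (\<Sum>i\<in>A. a i)" and "r \<ge> 2"
  shows "((\<Sum>i\<in>A. (a i)\<^sup>2) / (\<Sum>i\<in>A. a i)) powr (r - 1) \<le> (\<Sum>i\<in>A. a i powr r) / (\<Sum>i\<in>A. a i)"
proof -
  let ?s = "\<Sum>i\<in>A. a i"
  \<comment> \<open>The convexity fact is used on the open half-line, so Jensen is applied to the
    positive terms only. The zero terms contribute nothing to any of the three sums, since
    \<open>0 powr r = 0\<close>.\<close>
  define B where "B = {i\<in>A. 0 < a i}"
  have B: "finite B" "B \<subseteq> A" "\<And>i. i \<in> A - B \<Longrightarrow> a i = 0"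
    using \<open>finite A\<close> nonneg by (force simp: B_def)+
  have sums: "(\<Sum>i\<in>A. a i) = (\<Sum>i\<in>B. a i)" "(\<Sum>i\<in>A. (a i)\<^sup>2) = (\<Sum>i\<in>B. (a i)\<^sup>2)"
      "(\<Sum>i\<in>A. a i powr r) = (\<Sum>i\<in>B. a i powr r)"
    using B \<open>finite A\<close> by (auto intro!: sum.mono_neutral_right)
  have "(\<Sum>i\<in>B. (a i / ?s) *\<^sub>R a i) powr (r - 1) \<le> (\<Sum>i\<in>B. (a i / ?s) * a i powr (r - 1))"
  proof (intro convex_on_sum[of B "{0<..}" "\<lambda>t. t powr (r - 1)"])
    show "convex_on {0<..} (\<lambda>t. t powr (r - 1))"
      using \<open>r \<ge> 2\<close> by (intro powr_convex) simp
    show "B \<noteq> {}" using pos sums(1) by auto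
    show "(\<Sum>i\<in>B. a i / ?s) = 1"
      using pos sums(1) by (metis sum_divide_distrib divide_self less_irrefl)
    show "0 \<le> a i / ?s" "a i \<in> {0<..}" if "i \<in> B" for i
      using that pos by (simp_all add: B_def)
  qed (rule B(1))
  also have "(\<Sum>i\<in>B. (a i / ?s) * a i powr (r - 1)) = (\<Sum>i\<in>B. a i powr r / ?s)"
    by (intro sum.cong refl) (auto simp: powr_diff B_def)
  finally show ?thesis
    unfolding sums by (simp add: sum_divide_distrib power2_eq_square)
qed

section \<open>One indicator function at a fixed modulus\<close>

locale residue_subset =
  fixes d N :: nat and S :: "(nat \<Rightarrow> int) set"
  assumes N: "N \<ge> 2" and nonempty: "S \<noteq> {}" and subset: "S \<subseteq> zmod_vecs d N"
begin

definition L1 :: real where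
  "L1 = (\<Sum>\<xi>\<in>zmod_vecs d N. cmod (fourier d N (indicator S) \<xi>))"

lemma finite_S: "finite S"
  using subset finite_subset finite_zmod_vecs by blast

lemma card_pos: "card S > 0"
  using nonempty finite_S by (simp add: card_gt_0_iff)

lemma ln_N_pos: "ln (real N) > 0"
  using N by simp

lemma sum_indicator_S: "(\<Sum>x\<in>zmod_vecs d N. indicator S x) = (of_nat (card S) :: 'b::{semiring_1})"
  using subset by (simp add: indicator_def sum.If_cases Int_absorb1)

lemma sum_squares_fourier:
  "(\<Sum>\<xi>\<in>zmod_vecs d N. (cmod (fourier d N (indicator S) \<xi>))\<^sup>2) = real (card S)"
proof -
  have "(cmod (indicator S x))\<^sup>2 = indicator S x" for x
    by (simp add: indicator_def)
  then show ?thesis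
    using N by (simp add: parseval sum_indicator_S)
qed

lemma cmod_fourier_le_card:
  "cmod (fourier d N (indicator S) \<xi>) \<le> real N powr (- real d / 2) * real (card S)"
proof -
  have "cmod (indicator S x) = indicator S x" for x
    by (simp add: indicator_def)
  then show ?thesis
    using cmod_fourier_le[of d N "indicator S" \<xi>] by (simp add: sum_indicator_S)
qed

lemma cmod_fourier_zero:
  "cmod (fourier d N (indicator S) (zmod_zero d)) = real N powr (- real d / 2) * real (card S)"
  by (simp add: fourier_at_zero sum_indicator_S norm_mult)

text \<open>In Parseval's sum one factor of each square is replaced by the uniform bound
  \<open>?c\<close>. The cardinality then cancels, which is why the bound does not depend on
  \<open>S\<close>.\<close>

lemma L1_ge: "real N powr (real d / 2) \<le> L1"
proof -
  let ?F = "\<lambda>\<xi>. cmod (fourier d N (indicator S) \<xi>)"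
  let ?c = "real N powr (- real d / 2) * real (card S)"
  have "real (card S) = (\<Sum>\<xi>\<in>zmod_vecs d N. ?F \<xi> * ?F \<xi>)"
    using sum_squares_fourier by (simp add: power2_eq_square)
  also have "\<dots> \<le> (\<Sum>\<xi>\<in>zmod_vecs d N. ?c * ?F \<xi>)"
    by (intro sum_mono mult_right_mono cmod_fourier_le_card) simp
  also have "\<dots> = real (card S) * (L1 / real N powr (real d / 2))"
    using powr_minus_divide[of "real N" "real d / 2"]
    by (simp add: L1_def sum_distrib_left sum_divide_distrib)
  finally show ?thesis
    using card_pos N by (simp add: field_simps)
qed

lemma L1_pos: "L1 > 0"
  using N by (intro less_le_trans[OF _ L1_ge]) simp

text \<open>Cauchy-Schwarz against the constant 1 on the \<open>N ^ d\<close> frequencies, combined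
  with Parseval. This is what makes the exponent nonnegative.\<close>

lemma L1_le: "L1 \<le> sqrt (real (card S)) * real N powr (real d / 2)"
proof -
  have "L1\<^sup>2 \<le> real (card S) * real N ^ d"
    using Cauchy_Schwarz_ineq_sum[of "\<lambda>\<xi>. cmod (fourier d N (indicator S) \<xi>)" "\<lambda>_. 1" "zmod_vecs d N"]
    by (simp add: L1_def sum_squares_fourier card_zmod_vecs)
  also have "\<dots> = (sqrt (real (card S)) * real N powr (real d / 2))\<^sup>2"
    using N by (simp add: power_mult_distrib powr_power powr_realpow)
  finally show ?thesis
    by (rule power2_le_imp_le) simp
qed

text \<open>Parseval turns the denominator of the Fourier ratio into \<open>sqrt (card S)\<close>,
  so bounds on the exponent reduce to bounds on \<open>ln L1\<close>. Multiplying by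
  \<open>ln N\<close> keeps the identity linear in the logarithms.\<close>

lemma kappa_eq:
  "kappa d N (indicator S) * ln (real N) = real d / 2 * ln (real N) + ln (real (card S)) / 2 - ln L1"
proof -
  have "fourier_ratio d N (indicator S) = L1 / sqrt (real (card S))"
    using L1_pos
    by (simp add: fourier_ratio_def lp_norm_def L1_def sum_squares_fourier powr_half_sqrt)
  then show ?thesis
    using N card_pos L1_pos ln_N_pos
    by (simp add: kappa_def ln_div ln_mult ln_sqrt)
qed

text \<open>Supplies the lower half of the sandwich for the limit claim, which the limsup bound
  alone does not give.\<close>

lemma kappa_nonneg: "kappa d N (indicator S) \<ge> 0"
proof -
  have "ln L1 \<le> ln (sqrt (real (card S)) * real N powr (real d / 2))"
    using L1_le L1_pos by simp
  also have "\<dots> = ln (real (card S)) / 2 + real d / 2 * ln (real N)"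
    using N card_pos by (simp add: ln_mult ln_sqrt)
  finally have "0 \<le> kappa d N (indicator S) * ln (real N)"
    using kappa_eq by simp
  then show ?thesis
    using ln_N_pos by (simp add: zero_le_mult_iff)
qed

lemma kappa_le_half: "kappa d N (indicator S) \<le> ln (real (card S)) / ln (real N) / 2"
proof -
  have "ln (real N powr (real d / 2)) \<le> ln L1"
    using L1_ge N by (intro ln_mono) auto
  then have "real d / 2 * ln (real N) \<le> ln L1"
    using N by simp
  then have "kappa d N (indicator S) * ln (real N) \<le> ln (real (card S)) / 2"
    using kappa_eq by simp
  then show ?thesis
    using ln_N_pos by (simp add: field_simps)
qed

text \<open>The zero frequency carries energy \<open>n * (n / N ^ d)\<close> with
  \<open>n = card S\<close>, and the hypothesis bounds the ratio by 1/2.\<close>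

lemma sum_squares_nonzero_freq:
  assumes "2 * real (card S) \<le> real N ^ d"
  shows "real (card S) / 2
    \<le> (\<Sum>\<xi>\<in>zmod_vecs d N - {zmod_zero d}. (cmod (fourier d N (indicator S) \<xi>))\<^sup>2)"
proof -
  have "zmod_zero d \<in> zmod_vecs d N"
    using N by (auto simp: zmod_zero_def zmod_vecs_def)
  then have diff: "(\<Sum>\<xi>\<in>zmod_vecs d N - {zmod_zero d}. (cmod (fourier d N (indicator S) \<xi>))\<^sup>2)
      = real (card S) - (real N powr (- real d / 2) * real (card S))\<^sup>2"
    by (simp add: sum_diff1 sum_squares_fourier cmod_fourier_zero)
  have "(real N powr (- real d / 2) * real (card S))\<^sup>2 = real (card S) * (real (card S) / real N ^ d)"
    using N by (subst power_mult_distrib, subst powr_neg_half_squared) (simp_all add: power2_eq_square)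
  also have "\<dots> \<le> real (card S) * (1 / 2)"
    using assms N by (intro mult_left_mono) (simp_all add: field_simps)
  finally show ?thesis using diff by simp
qed

text \<open>A finite-scale form of the second bound: the losses from the factor 1/2 and from
  \<open>C\<close> are collected in a constant over \<open>ln N\<close>, which vanishes in the
  limit. The argument takes logarithms of the interpolation and Salem inequalities and eliminates
  \<open>Ar\<close>.\<close>

lemma kappa_le_salem:
  assumes "r > 2" and "C > 0" and card: "2 * real (card S) \<le> real N ^ d"
    and salem: "(real N powr (- real d) *
          (\<Sum>\<xi>\<in>zmod_vecs d N - {zmod_zero d}. cmod (fourier d N (indicator S) \<xi>) powr r))
            powr (1 / r) \<le> C * real N powr (- real d / 2) * real (card S) powr (1 - s)"
  shows "kappa d N (indicator S) \<le> r * (1 - 2 * s) / (2 * (r - 2)) * (ln (real (card S)) / ln (real N))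
           + ((r - 1) * ln 2 + r * ln C) / (r - 2) / ln (real N)"
proof -
  let ?F = "\<lambda>\<xi>. cmod (fourier d N (indicator S) \<xi>)"
  let ?V = "zmod_vecs d N - {zmod_zero d}"
  let ?L = "ln (real N)" and ?n = "real (card S)"
  define A1 A2 Ar where "A1 = (\<Sum>\<xi>\<in>?V. ?F \<xi>)" and "A2 = (\<Sum>\<xi>\<in>?V. (?F \<xi>)\<^sup>2)"
    and "Ar = (\<Sum>\<xi>\<in>?V. ?F \<xi> powr r)"
  have n: "?n > 0" using card_pos by simp
  have A2: "?n / 2 \<le> A2"
    unfolding A2_def by (rule sum_squares_nonzero_freq[OF card])
  \<comment> \<open>The energy bound \<open>A2\<close> rules out that the transform vanishes at all
    nonzero frequencies, so dividing by \<open>A1\<close> and taking its logarithm is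
    legitimate.\<close>
  have "A1 \<noteq> 0"
  proof
    assume "A1 = 0"
    then have "\<forall>\<xi>\<in>?V. ?F \<xi> = 0"
      by (simp add: A1_def sum_nonneg_eq_0_iff)
    then have "A2 = 0" by (simp add: A2_def)
    with A2 n show False by simp
  qed
  then have A1: "A1 > 0"
    by (metis A1_def less_eq_real_def norm_ge_zero sum_nonneg)
  have "A1 \<le> L1"
    unfolding A1_def L1_def by (intro sum_mono2) auto
  then have lnA1: "ln A1 \<le> ln L1" using A1 by simp
  have interp: "(A2 / A1) powr (r - 1) \<le> Ar / A1"
    unfolding A1_def A2_def Ar_def
    using A1 \<open>r > 2\<close> by (intro powr_sum_squares_le) (auto simp: A1_def)
  have "0 < (A2 / A1) powr (r - 1)" using A1 A2 n by simp
  with interp have Ar: "Ar > 0"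
    using A1 by (smt (verit) zero_less_divide_iff)
  have "(r - 1) * (ln A2 - ln A1) = ln ((A2 / A1) powr (r - 1))"
    using A1 A2 n by (simp add: ln_div)
  also have "\<dots> \<le> ln (Ar / A1)"
    using interp A1 A2 n by (intro ln_mono) auto
  also have "\<dots> = ln Ar - ln A1"
    using A1 Ar by (simp add: ln_div)
  finally have 1: "(r - 1) * (ln A2 - ln A1) \<le> ln Ar - ln A1" .
  have "(ln Ar - d * ?L) / r = ln ((real N powr (- real d) * Ar) powr (1 / r))"
    using N Ar by (simp add: ln_mult)
  also have "\<dots> \<le> ln (C * real N powr (- real d / 2) * ?n powr (1 - s))"
    using salem N Ar unfolding Ar_def[symmetric] by (intro ln_mono) auto
  also have "\<dots> = ln C - real d / 2 * ?L + (1 - s) * ln ?n"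
    using N n \<open>C > 0\<close> by (simp add: ln_mult)
  finally have 2: "ln Ar - d * ?L \<le> r * (ln C - real d / 2 * ?L + (1 - s) * ln ?n)"
    using \<open>r > 2\<close> by (simp add: field_simps)
  have "ln (?n / 2) \<le> ln A2"
    using A2 n by (intro ln_mono) auto
  then have "ln ?n - ln 2 \<le> ln A2"
    using n by (simp add: ln_div)
  then have "(r - 1) * (ln ?n - ln 2) \<le> (r - 1) * ln A2"
    using \<open>r > 2\<close> by (intro mult_left_mono) auto
  moreover have "(r - 2) * ln A1 \<le> (r - 2) * ln L1"
    using lnA1 \<open>r > 2\<close> by (intro mult_left_mono) auto
  moreover have "(r - 2) * (kappa d N (indicator S) * ?L)
      = (r - 2) * (real d / 2 * ?L + ln ?n / 2 - ln L1)"
    by (simp only: kappa_eq)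
  \<comment> \<open>Facts \<open>1\<close> and \<open>2\<close> bound
    \<open>(r - 1) * ln A2 - (r - 2) * ln A1\<close> from above. The \<open>ln N\<close> terms
    cancel because \<open>(r - 2) * d / 2 + d - r * d / 2 = 0\<close>, and \<open>ln ?n\<close> is
    left with the coefficient
    \<open>(r - 2) / 2 - (r - 1) + r * (1 - s) = r * (1 - 2 * s) / 2\<close>.\<close>
  ultimately have "(r - 2) * (kappa d N (indicator S) * ?L)
      \<le> r * (1 - 2 * s) / 2 * ln ?n + ((r - 1) * ln 2 + r * ln C)"
    using 1 2 by (simp add: field_simps)
  then have "kappa d N (indicator S)
      \<le> (r * (1 - 2 * s) / 2 * ln ?n + ((r - 1) * ln 2 + r * ln C)) / ((r - 2) * ?L)"
    using \<open>r > 2\<close> ln_N_pos by (simp add: pos_le_divide_eq mult_ac)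
  then show ?thesis
    by (simp add: add_divide_distrib del: right_diff_distrib_numeral)
qed

end

section \<open>Passage to the limit along the moduli\<close>

theorem theorem8p2:
  fixes d :: nat and M :: "nat set" and S :: "nat \<Rightarrow> (nat \<Rightarrow> int) set" and \<alpha> :: real
  assumes "d \<ge> 1"
    and "infinite M"
    and "\<And>N. N \<in> M \<Longrightarrow> N \<ge> 2"
    and "\<And>N. N \<in> M \<Longrightarrow> S N \<noteq> {}"
    and "\<And>N. N \<in> M \<Longrightarrow> S N \<subseteq> zmod_vecs d N"
    and "has_size_exponent M S \<alpha>"
    and "0 < \<alpha>" and "\<alpha> < real d"
  shows "(\<forall>r s::real. 2 < r \<and> 0 \<le> s \<and> s \<le> 1 / 2 \<and> uniformly_salem M d r s S \<longrightarrow>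
            kappa_upper M d (\<lambda>N. indicator (S N))
              \<le> ereal (min (\<alpha> / 2) (\<alpha> * r * (1 - 2 * s) / (2 * (r - 2))))) \<and>
         (\<forall>r::real. 2 < r \<and> uniformly_salem M d r (1 / 2) S \<longrightarrow>
            ((\<lambda>N. kappa d N (indicator (S N))) \<longlongrightarrow> 0) (moduli_at_top M))"
proof -
  let ?F = "moduli_at_top M"
  let ?k = "\<lambda>N. kappa d N (indicator (S N))"
  define q where "q N = ln (real (card (S N))) / ln (real N)" for N
  have res: "residue_subset d N (S N)" if "N \<in> M" for N
    using assms that by unfold_locales auto
  have inM: "\<forall>\<^sub>F N in ?F. N \<in> M"
    by (simp add: moduli_at_top_def eventually_inf_principal)
  \<comment> \<open>Properness of the filter is what allows the limsup of a convergent family to be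
    identified with its limit.\<close>
  have nontriv: "?F \<noteq> bot"
  proof
    assume "?F = bot"
    then have "\<forall>\<^sub>F N in at_top. N \<notin> M"
      by (simp add: moduli_at_top_def trivial_limit_def eventually_inf_principal)
    then obtain n where "\<And>N. N \<ge> n \<Longrightarrow> N \<notin> M"
      by (auto simp: eventually_at_top_linorder)
    then have "M \<subseteq> {..<n}" by (force simp: not_le[symmetric])
    then show False using assms(2) finite_subset by blast
  qed
  have q: "(q \<longlongrightarrow> \<alpha>) ?F"
    using assms(6) by (simp add: has_size_exponent_def q_def[abs_def])
  have inv_ln: "((\<lambda>N. K / ln (real N)) \<longlongrightarrow> 0) ?F" for K
  proof -
    have "((\<lambda>N::nat. K / ln (real N)) \<longlongrightarrow> 0) at_top"
      by real_asymp
    then show ?thesis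
      unfolding moduli_at_top_def by (rule tendsto_mono[OF inf_le1])
  qed
  \<comment> \<open>After taking logarithms and dividing by \<open>ln N\<close>, the claim compares
    \<open>q N + ln 2 / ln N\<close>, which tends to \<alpha>, with \<open>d\<close>.\<close>
  have small: "\<forall>\<^sub>F N in ?F. 2 * real (card (S N)) \<le> real N ^ d"
  proof -
    have "((\<lambda>N. q N + ln 2 / ln (real N)) \<longlongrightarrow> \<alpha> + 0) ?F"
      by (intro tendsto_add q inv_ln)
    then have "\<forall>\<^sub>F N in ?F. q N + ln 2 / ln (real N) < real d"
      using assms(8) by (intro order_tendstoD) auto
    with inM show ?thesis
    proof eventually_elim
      case (elim N)
      interpret residue_subset d N "S N" by (rule res[OF elim(1)])
      have "ln (2 * real (card (S N))) < ln (real N ^ d)"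
        using elim(2) ln_N_pos card_pos N by (simp add: q_def field_simps ln_mult ln_realpow)
      then show ?case
        using card_pos N by simp
    qed
  qed
  have salem: "\<exists>K. \<forall>\<^sub>F N in ?F. ?k N \<le> r * (1 - 2 * s) / (2 * (r - 2)) * q N + K / ln (real N)"
    if r: "2 < r" and us: "uniformly_salem M d r s S" for r s
  proof -
    obtain C where C: "\<And>N. N \<in> M \<Longrightarrow> (real N powr (- real d) *
          (\<Sum>\<xi>\<in>zmod_vecs d N - {zmod_zero d}. cmod (fourier d N (indicator (S N)) \<xi>) powr r))
            powr (1 / r) \<le> C * real N powr (- real d / 2) * real (card (S N)) powr (1 - s)"
      using us unfolding uniformly_salem_def by blast
    \<comment> \<open>The Salem constant comes without a sign, but its logarithm is needed;
      \<open>max C 1\<close> is positive and enlarging the constant preserves the estimate.\<close>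
    have "\<forall>\<^sub>F N in ?F. ?k N \<le> r * (1 - 2 * s) / (2 * (r - 2)) * q N
        + ((r - 1) * ln 2 + r * ln (max C 1)) / (r - 2) / ln (real N)"
      using inM small
    proof eventually_elim
      case (elim N)
      interpret residue_subset d N "S N" by (rule res[OF elim(1)])
      have "C * real N powr (- real d / 2) * real (card (S N)) powr (1 - s)
          \<le> max C 1 * real N powr (- real d / 2) * real (card (S N)) powr (1 - s)"
        by (intro mult_right_mono) auto
      with C[OF elim(1)] show ?case
        unfolding q_def by (intro kappa_le_salem r elim) auto
    qed
    then show ?thesis by blast
  qed
  have lim: "((\<lambda>N. c * q N + K / ln (real N)) \<longlongrightarrow> c * \<alpha>) ?F" for c K
    using tendsto_add[OF tendsto_mult[OF tendsto_const[of c] q] inv_ln[of K]] by simp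
  have upper: "kappa_upper M d (\<lambda>N. indicator (S N)) \<le> ereal (c * \<alpha>)"
    if "\<forall>\<^sub>F N in ?F. ?k N \<le> c * q N + K / ln (real N)" for c K
  proof -
    have "kappa_upper M d (\<lambda>N. indicator (S N)) \<le> Limsup ?F (\<lambda>N. ereal (c * q N + K / ln (real N)))"
      unfolding kappa_upper_def using that by (intro Limsup_mono) simp
    also have "\<dots> = ereal (c * \<alpha>)"
      using lim by (intro lim_imp_Limsup nontriv) simp
    finally show ?thesis .
  qed
  have half: "kappa_upper M d (\<lambda>N. indicator (S N)) \<le> ereal (1 / 2 * \<alpha>)"
  proof (rule upper[where K = 0])
    show "\<forall>\<^sub>F N in ?F. ?k N \<le> 1 / 2 * q N + 0 / ln (real N)"
      using inM by eventually_elim (use residue_subset.kappa_le_half[OF res] in \<open>simp add: q_def mult.commute\<close>)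
  qed
  show ?thesis
  proof (intro conjI allI impI)
    fix r s :: real
    assume "2 < r \<and> 0 \<le> s \<and> s \<le> 1 / 2 \<and> uniformly_salem M d r s S"
    then obtain K where "\<forall>\<^sub>F N in ?F. ?k N \<le> r * (1 - 2 * s) / (2 * (r - 2)) * q N + K / ln (real N)"
      using salem by blast
    from upper[OF this] half
    show "kappa_upper M d (\<lambda>N. indicator (S N))
        \<le> ereal (min (\<alpha> / 2) (\<alpha> * r * (1 - 2 * s) / (2 * (r - 2))))"
      by (simp add: min_def mult_ac)
  next
    fix r :: real
    assume "2 < r \<and> uniformly_salem M d r (1 / 2) S"
    then obtain K where K: "\<forall>\<^sub>F N in ?F. ?k N \<le> r * (1 - 2 * (1 / 2)) / (2 * (r - 2)) * q N + K / ln (real N)"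
      using salem by blast
    show "(?k \<longlongrightarrow> 0) ?F"
    \<comment> \<open>At \<open>s = 1 / 2\<close> the coefficient of \<open>q N\<close> is zero, so
      the upper bound is just \<open>K / ln N\<close>.\<close>
    proof (rule tendsto_sandwich[OF _ K])
      show "\<forall>\<^sub>F N in ?F. 0 \<le> ?k N"
        using inM by eventually_elim (rule residue_subset.kappa_nonneg[OF res])
    qed (use inv_ln[of K] in simp_all)
  qed
qed

end
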